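(* Let the regularity assumption (with constants $L,\kappa_H$) and the unbiasedness assumption stated in the context hold, let $\mu_1\in(0,1]$, and let TRSVR be run with the parameters (corresponding to $\gamma=2/3$) $$\alpha=\frac{\mu_0 b}{2(L+2\kappa_H)N^{2/3}}\in(0,1],\qquad b=\mu_1N^{2/3},\qquad S\le\left\lfloor\frac{N}{\mu_0\left(b+\frac{\mu_0L^2b}{2(L+2\kappa_H)}\right)}\right\rfloor ,$$ where $\mu_0\in(0,1)$ is the constant for which, together with a constant $v_0\in(0,1)$, the convergence bound recalled in the context holds. Then TRSVR achieves a sample complexity of $\mathcal{O}(N+N^{2/3}\epsilon^{-1})$ for finding a first-order $\epsilon$-stationary point.
   Context: Problem. Minimize $f(\boldsymbol{x})=\frac1N\sum_{i=1}^N f_i(\boldsymbol{x})$ over $\boldsymbol{x}\in\mathbb{R}^d$; $g(\boldsymbol{x})=\nabla f(\boldsymbol{x})$ is the full gradient. $\|\cdot\|$ is the $\ell_2$ norm for vectors and the operator norm for matrices; $[N]=\{1,\dots,N\}$. A point $\boldsymbol{x}$ is a first-order $\epsilon$-stationary point if $\mathbb{E}[\|g(\boldsymbol{x})\|^2]\le\epsilon$. Sample complexity is the total number of samples (component-gradient evaluations $\nabla f_i(\cdot)$) used by the algorithm to find such a point. Algorithm TRSVR (Trust-Region with Stochastic Variance Reduction). Inputs: initial point $\boldsymbol{x}_{0,0}$, batch size $b\in[1,N]$, integer inner-loop length $S>0$, radius-control parameter $\alpha>0$. For $k=0,1,2,\dots$: compute the full gradient $g_{k,0}=\frac1N\sum_{i=1}^N\nabla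 f_i(\boldsymbol{x}_{k,0})$; then for $s=0,\dots,S-1$: (1) select a mini-batch $I_{k,s}\subset[N]$ of size $b$, compute the mini-batch gradient $\tilde g_{k,s}=\frac1b\sum_{i\in I_{k,s}}\nabla f_i(\boldsymbol{x}_{k,s})$ and the variance-reduced gradient $\bar g_{k,s}=\frac1b\sum_{i\in I_{k,s}}\left(\nabla f_i(\boldsymbol{x}_{k,s})-\nabla f_i(\boldsymbol{x}_{k,0})\right)+g_{k,0}$; (2) set the trust-region radius $\Delta_{k,s}=\alpha\|\bar g_{k,s}\|$; (3) construct a Hessian approximation $H_{k,s}$ (a $d\times d$ matrix, which may be stochastic and may depend on $\bar g_{k,s}$) and compute an approximate solution $\Delta\boldsymbol{x}_{k,s}$ of the problem of minimizing $m(\Delta\boldsymbol{x})=\bar g_{k,s}^T\Delta\boldsymbol{x}+\frac12\Delta\boldsymbol{x}^TH_{k,s}\Delta\boldsymbol{x}$ subject to $\|\Delta\boldsymbol{x}\|\le\Delta_{k,s}$, which is feasible and achieves at least as much reduction in $m$ as the Cauchy point (the minimizer of $m$ over the feasible points of the form $-t\bar g_{k,s}$, $t\ge0$); (4) set $\boldsymbol{x}_{k,s+1}=\boldsymbol{x}_{k,s}+\Delta\boldsymbol{x}_{k,s}$. After the inner loop set $\boldsymbol{x}_{k+1,0}=\boldsymbol{x}_{k,S}$. Write $g_{k,s}=g(\boldsymbol{x}_{k,s})$. Regularity assumption. All iterates $\boldsymbol{x}_{k,s}$ lie in an open convex set $\mathcal{X}\subseteq\mathbb{R}^d$; $f$ is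 bounded below by $f_{\inf}$; each $f_i:\mathbb{R}^d\to\mathbb{R}$, $i\in[N]$, is continuously differentiable with $L$-Lipschitz continuous gradient; and, for some constant $\kappa_H$, $\|H_{k,s}\|\le\kappa_H$ for all $k\ge0$ and $0\le s\le S-1$. Unbiasedness assumption. The mini-batch gradient estimator is unbiased: $\mathbb{E}[\tilde g_{k,s}\mid\boldsymbol{x}_{k,s}]=g_{k,s}$. Convergence bound (defining the role of $\mu_0,v_0$): for every integer $K\ge0$, $$\mathbb{E}\left[\frac{1}{(K+1)S}\sum_{k=0}^{K}\sum_{s=0}^{S-1}\|g_{k,s}\|^2\right]\le\frac{2(L+\kappa_H)\left(\mathbb{E}[f(\boldsymbol{x}_{0,0})]-f_{\inf}\right)}{(K+1)S\,\mu_0\,\mu_1\,v_0}.$$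
   Formalization: The inner-loop length S must also be at least c times the stated floor, for a fixed c > 0 on which the O-constant may depend; for much shorter loops (e.g. S = 1, where TRSVR can be gradient descent costing order N/ε) the claimed bound is false. *)

theory Defs
  imports "HOL-Probability.Probability"
begin

section \<open>Finite-sum objectives\<close>

definition grad :: "(real^'d \<Rightarrow> real) \<Rightarrow> real^'d \<Rightarrow> real^'d" where
  "grad h y = (THE v. GDERIV h y :> v)"

definition objective :: "nat \<Rightarrow> (nat \<Rightarrow> real^'d \<Rightarrow> real) \<Rightarrow> real^'d \<Rightarrow> real" where
  "objective N f y = (1 / real N) * (\<Sum>i\<in>{1..N}. f i y)"

definition minibatch_grad ::
  "(nat \<Rightarrow> real^'d \<Rightarrow> real) \<Rightarrow> nat \<Rightarrow> nat set \<Rightarrow> real^'d \<Rightarrow> real^'d" where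
  "minibatch_grad f b B y = (1 / real b) *\<^sub>R (\<Sum>i\<in>B. grad (f i) y)"

text \<open>Here \<open>y\<close> is the current iterate and \<open>z\<close> the reference point of the outer iteration.\<close>

definition vr_grad ::
  "nat \<Rightarrow> (nat \<Rightarrow> real^'d \<Rightarrow> real) \<Rightarrow> nat \<Rightarrow> nat set \<Rightarrow> real^'d \<Rightarrow> real^'d \<Rightarrow> real^'d" where
  "vr_grad N f b B y z =
     (1 / real b) *\<^sub>R (\<Sum>i\<in>B. grad (f i) y - grad (f i) z)
     + (1 / real N) *\<^sub>R (\<Sum>i\<in>{1..N}. grad (f i) z)"


section \<open>Trust-region subproblem\<close>

definition tr_model :: "real^'d \<Rightarrow> real^'d^'d \<Rightarrow> real^'d \<Rightarrow> real" where
  "tr_model g H p = g \<bullet> p + 1 / 2 * (p \<bullet> (H *v p))"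

definition cauchy_point :: "real^'d \<Rightarrow> real^'d^'d \<Rightarrow> real \<Rightarrow> real^'d \<Rightarrow> bool" where
  "cauchy_point g H \<Delta> p \<longleftrightarrow>
     is_arg_min (tr_model g H) (\<lambda>q. (\<exists>t\<ge>0. q = - (t *\<^sub>R g)) \<and> norm q \<le> \<Delta>) p"

definition tr_step :: "real^'d \<Rightarrow> real^'d^'d \<Rightarrow> real \<Rightarrow> real^'d \<Rightarrow> bool" where
  "tr_step g H \<Delta> p \<longleftrightarrow>
     norm p \<le> \<Delta> \<and>
     (\<exists>c. cauchy_point g H \<Delta> c \<and>
        tr_model g H 0 - tr_model g H p \<ge> tr_model g H 0 - tr_model g H c)"


section \<open>The TRSVR algorithm\<close>

text \<open>
  A run of the method on a probability space \<open>M\<close>: \<open>x k s\<close> are the iterates, \<open>B k s\<close> the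
  mini-batches, \<open>H k s\<close> the Hessian approximations and \<open>dx k s\<close> the steps.
  The inner index of \<open>x\<close> ranges over \<open>0..S\<close>, that of the others over \<open>0..<S\<close>; values
  outside these ranges are irrelevant. Beyond the algorithmic rules nothing is required of
  the joint distribution of \<open>B\<close> and \<open>H\<close>; the sampling enters through \<open>unbiased\<close> below.
\<close>

locale trsvr = prob_space M for M :: "'w measure" +
  fixes N :: nat and f :: "nat \<Rightarrow> real^'d \<Rightarrow> real"
    and b S :: nat and \<alpha> :: real
    and x :: "nat \<Rightarrow> nat \<Rightarrow> 'w \<Rightarrow> real^'d"
    and B :: "nat \<Rightarrow> nat \<Rightarrow> 'w \<Rightarrow> nat set"
    and H :: "nat \<Rightarrow> nat \<Rightarrow> 'w \<Rightarrow> real^'d^'d"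
    and dx :: "nat \<Rightarrow> nat \<Rightarrow> 'w \<Rightarrow> real^'d"
  assumes batch_size: "1 \<le> b" "b \<le> N"
    and inner_length: "0 < S"
    and radius_param: "0 < \<alpha>"
    and x_measurable: "s \<le> S \<Longrightarrow> x k s \<in> borel_measurable M"
    and B_measurable: "s < S \<Longrightarrow> B k s \<in> measurable M (count_space UNIV)"
    and H_measurable: "s < S \<Longrightarrow> H k s \<in> borel_measurable M"
    and batch: "s < S \<Longrightarrow> \<omega> \<in> space M \<Longrightarrow> B k s \<omega> \<subseteq> {1..N} \<and> card (B k s \<omega>) = b"
    and step: "s < S \<Longrightarrow> \<omega> \<in> space M \<Longrightarrow>
      (let gbar = vr_grad N f b (B k s \<omega>) (x k s \<omega>) (x k 0 \<omega>)
       in tr_step gbar (H k s \<omega>) (\<alpha> * norm gbar) (dx k s \<omega>))"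
    and update: "s < S \<Longrightarrow> \<omega> \<in> space M \<Longrightarrow> x k (Suc s) \<omega> = x k s \<omega> + dx k s \<omega>"
    and restart: "\<omega> \<in> space M \<Longrightarrow> x (Suc k) 0 \<omega> = x k S \<omega>"


section \<open>Assumptions\<close>

definition regular ::
  "'w measure \<Rightarrow> nat \<Rightarrow> (nat \<Rightarrow> real^'d \<Rightarrow> real) \<Rightarrow> nat \<Rightarrow> (nat \<Rightarrow> nat \<Rightarrow> 'w \<Rightarrow> real^'d) \<Rightarrow>
   (nat \<Rightarrow> nat \<Rightarrow> 'w \<Rightarrow> real^'d^'d) \<Rightarrow> (real^'d) set \<Rightarrow> real \<Rightarrow> real \<Rightarrow> real \<Rightarrow> bool" where
  "regular M N f S x H X f_inf L \<kappa>H \<longleftrightarrow>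
     open X \<and> convex X \<and>
     (\<forall>k. \<forall>s\<le>S. \<forall>\<omega>\<in>space M. x k s \<omega> \<in> X) \<and>
     (\<forall>y. f_inf \<le> objective N f y) \<and>
     (\<forall>i\<in>{1..N}. (\<forall>y. f i differentiable at y) \<and> continuous_on UNIV (grad (f i)) \<and>
        L-lipschitz_on UNIV (grad (f i))) \<and>
     (\<forall>k. \<forall>s<S. \<forall>\<omega>\<in>space M. onorm ((*v) (H k s \<omega>)) \<le> \<kappa>H)"

text \<open>
  The library's conditional expectation is real-valued, so the vector identity is stated
  componentwise; \<open>vimage_algebra (space M) (x k s) borel\<close> is the sigma-algebra generated
  by \<open>x k s\<close>.
\<close>

definition unbiased ::
  "'w measure \<Rightarrow> nat \<Rightarrow> (nat \<Rightarrow> real^'d \<Rightarrow> real) \<Rightarrow> nat \<Rightarrow> nat \<Rightarrow> (nat \<Rightarrow> nat \<Rightarrow> 'w \<Rightarrow> real^'d) \<Rightarrow>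
   (nat \<Rightarrow> nat \<Rightarrow> 'w \<Rightarrow> nat set) \<Rightarrow> bool" where
  "unbiased M N f b S x B \<longleftrightarrow>
     (\<forall>k. \<forall>s<S. \<forall>j. AE \<omega> in M.
        real_cond_exp M (vimage_algebra (space M) (x k s) borel)
          (\<lambda>\<omega>. minibatch_grad f b (B k s \<omega>) (x k s \<omega>) $ j) \<omega>
        = grad (objective N f) (x k s \<omega>) $ j)"

text \<open>
  Expectations of nonnegative quantities are taken in \<open>[0, \<infinity>]\<close> (\<open>nn_integral\<close>), so that an
  upper bound on them includes integrability.
\<close>

definition convergence_bound ::
  "'w measure \<Rightarrow> nat \<Rightarrow> (nat \<Rightarrow> real^'d \<Rightarrow> real) \<Rightarrow> nat \<Rightarrow> (nat \<Rightarrow> nat \<Rightarrow> 'w \<Rightarrow> real^'d) \<Rightarrow>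
   real \<Rightarrow> real \<Rightarrow> real \<Rightarrow> real \<Rightarrow> real \<Rightarrow> real \<Rightarrow> bool" where
  "convergence_bound M N f S x f_inf L \<kappa>H \<mu>0 \<mu>1 v0 \<longleftrightarrow>
     (\<forall>K::nat.
        (\<integral>\<^sup>+\<omega>. ennreal (1 / (real (K + 1) * real S) *
            (\<Sum>k\<in>{0..K}. \<Sum>s\<in>{0..<S}. (norm (grad (objective N f) (x k s \<omega>)))\<^sup>2)) \<partial>M)
        \<le> ennreal (2 * (L + \<kappa>H) * ((\<integral>\<omega>. objective N f (x 0 0 \<omega>) \<partial>M) - f_inf)
                   / (real (K + 1) * real S * \<mu>0 * \<mu>1 * v0)))"


section \<open>Stationarity and sample complexity\<close>

definition eps_stationary ::
  "'p measure \<Rightarrow> (real^'d \<Rightarrow> real) \<Rightarrow> real \<Rightarrow> ('p \<Rightarrow> real^'d) \<Rightarrow> bool" where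
  "eps_stationary P F \<epsilon> Y \<longleftrightarrow>
     Y \<in> borel_measurable P \<and> (\<integral>\<^sup>+\<omega>. ennreal ((norm (grad F (Y \<omega>)))\<^sup>2) \<partial>P) \<le> ennreal \<epsilon>"

text \<open>
  Number of component gradients evaluated until \<open>x k s\<close> is available: an outer iteration costs
  \<open>N\<close> for the full gradient at \<open>x k 0\<close>, and each inner step \<open>b\<close> evaluations at the current iterate
  and \<open>b\<close> at \<open>x k 0\<close> (the latter are not assumed to have been stored).
\<close>

definition samples :: "nat \<Rightarrow> nat \<Rightarrow> nat \<Rightarrow> nat \<Rightarrow> nat \<Rightarrow> nat" where
  "samples N b S k s = k * (N + S * (2 * b)) + (if s = 0 then 0 else N + s * (2 * b))"

text \<open>
  Two readings of finding a stationary point; both are \<open>\<infinity>\<close> if none is ever found. The first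
  counts the samples needed to reach an iterate that is stationary. In the second, the method is
  run for \<open>K + 1\<close> full outer iterations and returns an iterate drawn uniformly at random,
  independently of the run.
\<close>

definition sample_complexity ::
  "'w measure \<Rightarrow> nat \<Rightarrow> (nat \<Rightarrow> real^'d \<Rightarrow> real) \<Rightarrow> nat \<Rightarrow> nat \<Rightarrow> (nat \<Rightarrow> nat \<Rightarrow> 'w \<Rightarrow> real^'d) \<Rightarrow>
   real \<Rightarrow> ennreal" where
  "sample_complexity M N f b S x \<epsilon> =
     (INF (k, s)\<in>{(k, s). s < S \<and> eps_stationary M (objective N f) \<epsilon> (x k s)}.
        of_nat (samples N b S k s))"

definition sample_complexity_random_output ::
  "'w measure \<Rightarrow> nat \<Rightarrow> (nat \<Rightarrow> real^'d \<Rightarrow> real) \<Rightarrow> nat \<Rightarrow> nat \<Rightarrow> (nat \<Rightarrow> nat \<Rightarrow> 'w \<Rightarrow> real^'d) \<Rightarrow>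
   real \<Rightarrow> ennreal" where
  "sample_complexity_random_output M N f b S x \<epsilon> =
     (INF K\<in>{K. eps_stationary (M \<Otimes>\<^sub>M uniform_count_measure ({0..K} \<times> {0..<S}))
                  (objective N f) \<epsilon> (\<lambda>(\<omega>, k, s). x k s \<omega>)}.
        of_nat (samples N b S (K + 1) 0))"

text \<open>
  The upper limit for the inner-loop length \<open>S\<close>. The complexity bound, uniform in \<open>N\<close>, is not true
  for arbitrarily short inner loops (for \<open>S = 1\<close> every step needs a full gradient and the cost is
  of order \<open>N / \<epsilon>\<close>), so the constant in it depends on a \<open>c > 0\<close> with
  \<open>c * max_inner_length \<le> S \<le> max_inner_length\<close>; \<open>c = 1\<close> is the maximal choice of \<open>S\<close>.
\<close>

definition max_inner_length :: "nat \<Rightarrow> nat \<Rightarrow> real \<Rightarrow> real \<Rightarrow> real \<Rightarrow> int" where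
  "max_inner_length N b L \<kappa>H \<mu>0 =
     \<lfloor>real N / (\<mu>0 * (real b + \<mu>0 * L\<^sup>2 * real b / (2 * (L + 2 * \<kappa>H))))\<rfloor>"

end

theory Submission
  imports Defs
begin

text \<open>
  The convergence bound decays like \<open>1 / ((K + 1) * S * \<mu>1)\<close>, while \<open>K + 1\<close> outer iterations cost
  \<open>(K + 1) * (N + 2 * S * b)\<close> samples. The parameters balance these two quantities. As \<open>S\<close> lies
  between \<open>c\<close> times the maximal inner length and that length, \<open>S * b\<close> is of the exact order \<open>N\<close>
  (\<open>inner_samples_bounds\<close>). The upper estimate says that the inner loop costs no more, up to a
  constant, than the full gradient that precedes it, so that an outer iteration costs \<open>O(N)\<close>.
  The lower estimate, with \<open>b = \<mu>1 * N powr (2 / 3)\<close>, says that \<open>S * \<mu>1\<close> is at least of order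
  \<open>N powr (1 / 3)\<close>, so that the bound is at most \<open>C1 / ((K + 1) * N powr (1 / 3))\<close>
  (\<open>convergence_bound_le\<close>); here \<open>\<mu>1\<close> has cancelled, and \<open>C1\<close> depends only on \<open>L\<close>, \<open>\<kappa>H\<close>,
  \<open>\<mu>0\<close>, \<open>v0\<close>, \<open>D\<close> and \<open>c\<close>. An integer \<open>K + 1\<close> that is at least \<open>C1 / (N powr (1 / 3) * \<epsilon>)\<close>, and
  exceeds it by at most one, makes the bound at most \<open>\<epsilon>\<close>. The total cost is then of order
  \<open>N * (C1 / (N powr (1 / 3) * \<epsilon>) + 1) = C1 * N powr (2 / 3) / \<epsilon> + N\<close>
  (\<open>samples_le_of_outer_count\<close>).

  A bound on the averaged squared gradient norm gives both readings of finding a stationary point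
  (\<open>sample_complexity_le_of_average\<close>): some iterate is no worse than the average, and for an output
  index drawn uniformly and independently of the run the expected squared gradient norm \<^emph>\<open>is\<close> the
  average, by Tonelli's theorem. Both arguments exchange integrals with sums, for which the gradient
  of the objective has to be a measurable function; this follows from its continuity once it is
  identified with the mean of the component gradients.
\<close>

section \<open>Gradients of the objective\<close>

lemma GDERIV_imp_grad_eq:
  assumes "GDERIV h y :> v"
  shows "grad h y = v"
  unfolding grad_def
proof (rule the_equality)
  fix w assume "GDERIV h y :> w"
  with assms have "(\<lambda>z. z \<bullet> v) = (\<lambda>z. z \<bullet> w)"
    unfolding gderiv_def by (rule has_derivative_unique)
  then have "\<forall>z. z \<bullet> w = z \<bullet> v" by metis
  then show "w = v" by (simp add: vector_eq_ldot)
qed (fact assms)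

text \<open>
  The gradient exists by the Riesz representation of the derivative, which in finite dimension is
  the adjoint of the derivative applied to \<open>1\<close>.
\<close>

lemma differentiable_imp_GDERIV_grad:
  fixes h :: "real^'d \<Rightarrow> real"
  assumes "h differentiable at y"
  shows "GDERIV h y :> grad h y"
proof -
  obtain h' where h': "(h has_derivative h') (at y)"
    using assms by (auto simp: differentiable_def)
  then have "linear h'" by (rule has_derivative_linear)
  then have "h' = (\<lambda>z. z \<bullet> adjoint h' 1)"
    by (simp add: adjoint_works fun_eq_iff)
  with h' have "GDERIV h y :> adjoint h' 1"
    unfolding gderiv_def by simp
  then show ?thesis by (metis GDERIV_imp_grad_eq)
qed

lemma grad_objective:
  fixes f :: "nat \<Rightarrow> real^'d \<Rightarrow> real"
  assumes "\<And>i. i \<in> {1..N} \<Longrightarrow> f i differentiable at y"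
  shows "grad (objective N f) y = (1 / real N) *\<^sub>R (\<Sum>i\<in>{1..N}. grad (f i) y)"
proof (rule GDERIV_imp_grad_eq)
  have "((\<lambda>y. (1 / real N) * (\<Sum>i\<in>{1..N}. f i y)) has_derivative
      (\<lambda>z. (1 / real N) * (\<Sum>i\<in>{1..N}. z \<bullet> grad (f i) y))) (at y)"
    using differentiable_imp_GDERIV_grad[OF assms, unfolded gderiv_def]
    by (intro has_derivative_mult_right has_derivative_sum) auto
  then show "GDERIV (objective N f) y :> (1 / real N) *\<^sub>R (\<Sum>i\<in>{1..N}. grad (f i) y)"
    unfolding gderiv_def objective_def by (simp add: inner_sum_right)
qed

lemma borel_measurable_grad_objective:
  fixes f :: "nat \<Rightarrow> real^'d \<Rightarrow> real"
  assumes "\<And>i y. i \<in> {1..N} \<Longrightarrow> f i differentiable at y"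
    and "\<And>i. i \<in> {1..N} \<Longrightarrow> continuous_on UNIV (grad (f i))"
  shows "grad (objective N f) \<in> borel_measurable borel"
proof (rule borel_measurable_continuous_onI)
  have "grad (objective N f) = (\<lambda>y. (1 / real N) *\<^sub>R (\<Sum>i\<in>{1..N}. grad (f i) y))"
    using assms(1) by (intro ext grad_objective)
  then show "continuous_on UNIV (grad (objective N f))"
    using assms(2) by (auto intro!: continuous_intros)
qed


section \<open>Averages over a finite index set\<close>

lemma nn_integral_average:
  assumes "finite A" and "\<And>i. i \<in> A \<Longrightarrow> h i \<in> borel_measurable M"
    and nonneg: "\<And>i \<omega>. 0 \<le> h i \<omega>"
  shows "(\<integral>\<^sup>+\<omega>. ennreal (1 / real (card A) * (\<Sum>i\<in>A. h i \<omega>)) \<partial>M)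
    = ennreal (1 / real (card A)) * (\<Sum>i\<in>A. \<integral>\<^sup>+\<omega>. ennreal (h i \<omega>) \<partial>M)"
proof -
  have "(\<integral>\<^sup>+\<omega>. ennreal (1 / real (card A) * (\<Sum>i\<in>A. h i \<omega>)) \<partial>M)
    = (\<integral>\<^sup>+\<omega>. ennreal (1 / real (card A)) * (\<Sum>i\<in>A. ennreal (h i \<omega>)) \<partial>M)"
    by (simp only: sum_ennreal nonneg ennreal_mult sum_nonneg divide_nonneg_nonneg
        zero_le_one of_nat_0_le_iff)
  also have "\<dots> = ennreal (1 / real (card A)) * (\<integral>\<^sup>+\<omega>. (\<Sum>i\<in>A. ennreal (h i \<omega>)) \<partial>M)"
    using assms(2) by (intro nn_integral_cmult) measurable
  also have "(\<integral>\<^sup>+\<omega>. (\<Sum>i\<in>A. ennreal (h i \<omega>)) \<partial>M) = (\<Sum>i\<in>A. \<integral>\<^sup>+\<omega>. ennreal (h i \<omega>) \<partial>M)"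
    using assms(2) by (intro nn_integral_sum) measurable
  finally show ?thesis .
qed

text \<open>
  The index with the least expectation is a witness: the sum is at least \<open>card A\<close> times the minimum,
  and this holds in \<open>[0, \<infinity>]\<close> even if some of the expectations are infinite.
\<close>

lemma exists_nn_integral_le_average:
  assumes "finite A" "A \<noteq> {}" and meas: "\<And>i. i \<in> A \<Longrightarrow> h i \<in> borel_measurable M"
    and nonneg: "\<And>i \<omega>. 0 \<le> h i \<omega>"
  shows "\<exists>i\<in>A. (\<integral>\<^sup>+\<omega>. ennreal (h i \<omega>) \<partial>M)
    \<le> (\<integral>\<^sup>+\<omega>. ennreal (1 / real (card A) * (\<Sum>i\<in>A. h i \<omega>)) \<partial>M)"
proof -
  define e where "e i = (\<integral>\<^sup>+\<omega>. ennreal (h i \<omega>) \<partial>M)" for i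
  have "Min (e ` A) \<in> e ` A" using assms by (intro Min_in) auto
  then obtain i where i: "i \<in> A" "e i = Min (e ` A)" by auto
  then have "of_nat (card A) * e i \<le> (\<Sum>j\<in>A. e j)"
    using assms(1) by (intro sum_bounded_below) auto
  then have "ennreal (1 / real (card A)) * (of_nat (card A) * e i)
      \<le> ennreal (1 / real (card A)) * (\<Sum>j\<in>A. e j)"
    by (rule mult_left_mono) auto
  moreover have "ennreal (1 / real (card A)) * (of_nat (card A) * e i) = e i"
    using assms(1,2)
    by (simp add: mult.assoc[symmetric] ennreal_of_nat_eq_real_of_nat ennreal_mult[symmetric])
  ultimately show ?thesis
    using i(1) nn_integral_average[OF assms(1) meas nonneg] unfolding e_def by auto
qed

text \<open>
  The uniform counting measure carries the discrete \<open>\<sigma>\<close>-algebra, so over a countable index set joint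
  measurability reduces to that of the sections \<open>Y i\<close>.
\<close>

lemma measurable_random_index:
  assumes "finite A" and "\<And>i. i \<in> A \<Longrightarrow> Y i \<in> measurable M K"
  shows "(\<lambda>(\<omega>, i). Y i \<omega>) \<in> measurable (M \<Otimes>\<^sub>M uniform_count_measure A) K"
proof -
  have "(\<lambda>p. Y (snd p) (fst p)) \<in> measurable (M \<Otimes>\<^sub>M count_space A) K"
    using assms
    by (intro measurable_compose_countable'[where f="\<lambda>i p. Y i (fst p)" and g=snd and I=A])
       (auto intro: countable_finite)
  moreover have "sets (M \<Otimes>\<^sub>M uniform_count_measure A) = sets (M \<Otimes>\<^sub>M count_space A)"
    by (intro sets_pair_measure_cong) (auto simp: sets_uniform_count_measure_count_space)
  ultimately show ?thesis
    by (subst measurable_cong_sets) (auto simp: case_prod_beta)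
qed

lemma nn_integral_random_index:
  assumes "finite A" "A \<noteq> {}" and meas: "\<And>i. i \<in> A \<Longrightarrow> h i \<in> borel_measurable M"
    and nonneg: "\<And>i \<omega>. 0 \<le> h i \<omega>"
  shows "(\<integral>\<^sup>+(\<omega>, i). ennreal (h i \<omega>) \<partial>(M \<Otimes>\<^sub>M uniform_count_measure A))
    = (\<integral>\<^sup>+\<omega>. ennreal (1 / real (card A) * (\<Sum>i\<in>A. h i \<omega>)) \<partial>M)"
proof -
  interpret U: prob_space "uniform_count_measure A"
    using assms(1,2) by (rule prob_space_uniform_count_measure)
  have "(\<lambda>(\<omega>, i). ennreal (h i \<omega>)) \<in> borel_measurable (M \<Otimes>\<^sub>M uniform_count_measure A)"
    using assms(1) meas by (intro measurable_random_index) auto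
  then have "(\<integral>\<^sup>+(\<omega>, i). ennreal (h i \<omega>) \<partial>(M \<Otimes>\<^sub>M uniform_count_measure A))
    = (\<integral>\<^sup>+\<omega>. \<integral>\<^sup>+i. ennreal (h i \<omega>) \<partial>uniform_count_measure A \<partial>M)"
    by (simp add: U.nn_integral_fst[symmetric])
  also have "\<dots> = (\<integral>\<^sup>+\<omega>. ennreal (1 / real (card A) * (\<Sum>i\<in>A. h i \<omega>)) \<partial>M)"
    using assms(1) unfolding uniform_count_measure_def
    by (simp add: nn_integral_point_measure_finite sum_distrib_left nonneg
        ennreal_mult[symmetric] sum_ennreal del: times_divide_eq_left)
  finally show ?thesis .
qed


section \<open>Inner-loop length\<close>

text \<open>
  With \<open>a = L + 2 * \<kappa>H\<close> and \<open>t = N powr (2 / 3)\<close> the quotient is the radius parameter \<open>\<alpha>\<close>, whose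
  positivity determines the sign of \<open>a\<close>. Division by zero gives zero, which excludes \<open>a = 0\<close>.
\<close>

lemma radius_pos_imp_curvature_pos:
  fixes \<mu>0 a t :: real
  assumes "0 < \<mu>0 * real b / (2 * a * t)" "0 < \<mu>0" "0 \<le> t"
  shows "0 < a"
proof (rule ccontr)
  assume "\<not> 0 < a"
  then have "2 * a * t \<le> 0" using assms(3) by (simp add: mult_nonpos_nonneg)
  then have "\<mu>0 * real b / (2 * a * t) \<le> 0"
    using assms(2) by (intro divide_nonneg_nonpos) simp_all
  with assms(1) show False by simp
qed

text \<open>
  Rounding down costs at most a factor of two once the result is positive. This is what makes the
  maximal inner length, which is at least \<open>S \<ge> 1\<close>, comparable to its unrounded value.
\<close>

lemma floor_ge_half:
  fixes r :: real
  assumes "1 \<le> \<lfloor>r\<rfloor>"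
  shows "r / 2 \<le> real_of_int \<lfloor>r\<rfloor>"
  using assms real_of_int_floor_add_one_gt[of r] by linarith

text \<open>
  The maximal inner length is \<open>N / (\<mu>0 * q * b)\<close> rounded down, so the batch size cancels in
  \<open>S * b\<close> and only \<open>N\<close> and problem constants remain.
\<close>

lemma inner_samples_bounds:
  fixes L \<kappa>H \<mu>0 c :: real
  defines "q \<equiv> 1 + \<mu>0 * L\<^sup>2 / (2 * (L + 2 * \<kappa>H))"
  assumes "0 < \<mu>0" "0 < L + 2 * \<kappa>H" "0 < c" "0 < b" "0 < S"
    and upper: "int S \<le> max_inner_length N b L \<kappa>H \<mu>0"
    and lower: "c * real_of_int (max_inner_length N b L \<kappa>H \<mu>0) \<le> real S"
  shows "real S * real b \<le> real N / \<mu>0"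
    and "c * real N / (2 * \<mu>0 * q) \<le> real S * real b"
proof -
  define r where "r = real N / (\<mu>0 * q * real b)"
  have q: "1 \<le> q" using assms(2-3) by (simp add: q_def)
  have T: "max_inner_length N b L \<kappa>H \<mu>0 = \<lfloor>r\<rfloor>"
    unfolding max_inner_length_def r_def q_def by (simp add: algebra_simps)
  have rb: "r * real b = real N / (\<mu>0 * q)"
    using \<open>0 < b\<close> by (simp add: r_def)
  have "real S \<le> r" using upper unfolding T by linarith
  then have "real S * real b \<le> real N / (\<mu>0 * q)"
    unfolding rb[symmetric] by (rule mult_right_mono) simp
  also have "\<dots> \<le> real N / \<mu>0"
    using q assms(2) by (intro divide_left_mono) auto
  finally show "real S * real b \<le> real N / \<mu>0" .
  have "r / 2 \<le> real_of_int \<lfloor>r\<rfloor>"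
    using upper \<open>0 < S\<close> unfolding T by (intro floor_ge_half) linarith
  then have "c * (r / 2) \<le> real S"
    using lower \<open>0 < c\<close> unfolding T by (meson mult_left_mono less_imp_le order_trans)
  then have "c * (r / 2) * real b \<le> real S * real b" by (rule mult_right_mono) simp
  also have "c * (r / 2) * real b = c / 2 * (r * real b)" by simp
  also have "\<dots> = c * real N / (2 * \<mu>0 * q)" unfolding rb by simp
  finally show "c * real N / (2 * \<mu>0 * q) \<le> real S * real b" .
qed


section \<open>From the averaged bound to sample complexity\<close>

lemma samples_mono:
  assumes "k \<le> K" "s < S"
  shows "samples N b S k s \<le> samples N b S (K + 1) 0"
proof -
  have "k * (N + S * (2 * b)) \<le> K * (N + S * (2 * b))"
    using assms(1) by (rule mult_right_mono) simp
  moreover have "s * (2 * b) \<le> S * (2 * b)"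
    using assms(2) by (intro mult_right_mono) auto
  ultimately have "k * (N + S * (2 * b)) + (N + s * (2 * b))
      \<le> K * (N + S * (2 * b)) + (N + S * (2 * b))"
    by linarith
  also have "\<dots> = samples N b S (K + 1) 0" by (simp add: samples_def)
  finally show ?thesis by (simp add: samples_def)
qed

text \<open>
  The pairs of an outer and an inner index are treated as one finite index set. A stationary iterate
  inside the first \<open>K + 1\<close> outer iterations is charged for all of them.
\<close>

lemma sample_complexity_le_of_average:
  fixes x :: "nat \<Rightarrow> nat \<Rightarrow> 'w \<Rightarrow> real^'d" and K :: nat
  assumes "0 < S"
    and x_meas: "\<And>k s. s < S \<Longrightarrow> x k s \<in> borel_measurable M"
    and grad_meas: "grad (objective N f) \<in> borel_measurable borel"
    and average: "(\<integral>\<^sup>+\<omega>. ennreal (1 / (real (K + 1) * real S) *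
        (\<Sum>k\<in>{0..K}. \<Sum>s\<in>{0..<S}. (norm (grad (objective N f) (x k s \<omega>)))\<^sup>2)) \<partial>M) \<le> ennreal \<epsilon>"
  shows "sample_complexity M N f b S x \<epsilon> \<le> of_nat (samples N b S (K + 1) 0)"
    and "sample_complexity_random_output M N f b S x \<epsilon> \<le> of_nat (samples N b S (K + 1) 0)"
proof -
  define A where "A = {0..K} \<times> {0..<S}"
  define h where "h = (\<lambda>(k, s) \<omega>. (norm (grad (objective N f) (x k s \<omega>)))\<^sup>2)"
  have A: "finite A" "A \<noteq> {}" "card A = (K + 1) * S"
    using \<open>0 < S\<close> by (auto simp: A_def)
  have x_meas': "i \<in> A \<Longrightarrow> case_prod x i \<in> borel_measurable M" for i
    using x_meas by (auto simp: A_def)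
  have h_meas: "h i \<in> borel_measurable M" if "i \<in> A" for i
    using x_meas'[OF that] grad_meas unfolding h_def
    by (cases i) (auto intro!: borel_measurable_power borel_measurable_norm
        intro: measurable_compose)
  have nonneg: "0 \<le> h i \<omega>" for i \<omega> by (simp add: h_def case_prod_beta)
  have average': "(\<integral>\<^sup>+\<omega>. ennreal (1 / real (card A) * (\<Sum>i\<in>A. h i \<omega>)) \<partial>M) \<le> ennreal \<epsilon>"
  proof -
    have "(\<Sum>i\<in>A. h i \<omega>)
        = (\<Sum>k\<in>{0..K}. \<Sum>s\<in>{0..<S}. (norm (grad (objective N f) (x k s \<omega>)))\<^sup>2)" for \<omega>
      unfolding A_def h_def by (subst sum.cartesian_product) (simp add: case_prod_beta')
    with average show ?thesis by (simp only: A(3) of_nat_mult)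
  qed
  obtain i where i: "i \<in> A" "(\<integral>\<^sup>+\<omega>. ennreal (h i \<omega>) \<partial>M)
      \<le> (\<integral>\<^sup>+\<omega>. ennreal (1 / real (card A) * (\<Sum>i\<in>A. h i \<omega>)) \<partial>M)"
    using exists_nn_integral_le_average[of A h M, OF A(1,2) h_meas nonneg] by (rule bexE)
  obtain k s where "i = (k, s)" by (cases i)
  with i(1) order_trans[OF i(2) average']
  have ks: "(k, s) \<in> A" "(\<integral>\<^sup>+\<omega>. ennreal (h (k, s) \<omega>) \<partial>M) \<le> ennreal \<epsilon>"
    by simp_all
  then have "eps_stationary M (objective N f) \<epsilon> (x k s)"
    using x_meas by (auto simp: eps_stationary_def A_def h_def)
  then have "sample_complexity M N f b S x \<epsilon> \<le> of_nat (samples N b S k s)"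
    unfolding sample_complexity_def using ks(1)
    by (intro INF_lower2[of "(k, s)"]) (auto simp: A_def)
  also have "\<dots> \<le> of_nat (samples N b S (K + 1) 0)"
    using ks(1) by (intro of_nat_mono samples_mono) (auto simp: A_def)
  finally show "sample_complexity M N f b S x \<epsilon> \<le> of_nat (samples N b S (K + 1) 0)" .
  have "eps_stationary (M \<Otimes>\<^sub>M uniform_count_measure A) (objective N f) \<epsilon> (\<lambda>(\<omega>, k, s). x k s \<omega>)"
    unfolding eps_stationary_def
  proof
    show "(\<lambda>(\<omega>, k, s). x k s \<omega>) \<in> borel_measurable (M \<Otimes>\<^sub>M uniform_count_measure A)"
      using measurable_random_index[OF A(1) x_meas'] by (simp add: case_prod_beta)
    show "(\<integral>\<^sup>+p. ennreal ((norm (grad (objective N f) ((\<lambda>(\<omega>, k, s). x k s \<omega>) p)))\<^sup>2)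
        \<partial>(M \<Otimes>\<^sub>M uniform_count_measure A)) \<le> ennreal \<epsilon>"
      using nn_integral_random_index[of A h M, OF A(1,2) h_meas nonneg] average'
      by (simp add: h_def case_prod_unfold)
  qed
  then show "sample_complexity_random_output M N f b S x \<epsilon> \<le> of_nat (samples N b S (K + 1) 0)"
    unfolding sample_complexity_random_output_def A_def
    by (intro INF_lower2[of K]) auto
qed

lemma outer_iteration_count:
  fixes r :: real
  assumes "0 \<le> r"
  obtains K :: nat where "r \<le> real (K + 1)" "real (K + 1) \<le> r + 1"
proof
  show "r \<le> real (nat \<lfloor>r\<rfloor> + 1)" "real (nat \<lfloor>r\<rfloor> + 1) \<le> r + 1"
    using assms by linarith+
qed

text \<open>
  The rounding term \<open>1\<close> in the outer count pays for one outer iteration, that is \<open>N\<close> up to a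
  constant; the main term pays \<open>N / N powr (1 / 3) = N powr (2 / 3)\<close> per unit of \<open>C1 / \<epsilon>\<close>.
\<close>

lemma samples_le_of_outer_count:
  fixes \<mu>0 C1 \<epsilon> :: real
  assumes "0 < N" "0 < \<mu>0" "0 < \<epsilon>" "0 \<le> C1"
    and inner: "real S * real b \<le> real N / \<mu>0"
    and count: "real (K + 1) \<le> C1 / (real N powr (1 / 3) * \<epsilon>) + 1"
  shows "real (samples N b S (K + 1) 0)
    \<le> (1 + 2 / \<mu>0) * (1 + C1) * (real N + real N powr (2 / 3) / \<epsilon>)"
proof -
  have N: "real N = real N powr (1 / 3) * real N powr (2 / 3)"
    using \<open>0 < N\<close> by (simp add: powr_add[symmetric])
  have total: "(1 + 2 / \<mu>0) * (real (K + 1) * real N)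
      \<le> (1 + 2 / \<mu>0) * ((1 + C1) * (real N + real N powr (2 / 3) / \<epsilon>))"
  proof (rule mult_left_mono)
    have "real (K + 1) * real N \<le> (C1 / (real N powr (1 / 3) * \<epsilon>) + 1) * real N"
      using count by (rule mult_right_mono) simp
    also have "\<dots> = real N + C1 * (real N powr (2 / 3) / \<epsilon>)"
      using \<open>0 < N\<close> by (simp add: ring_distribs) (subst N, simp)
    also have "\<dots> \<le> (1 + C1) * (real N + real N powr (2 / 3) / \<epsilon>)"
    proof -
      have "0 \<le> C1 * real N" "0 \<le> real N powr (2 / 3) / \<epsilon>"
        using \<open>0 < \<epsilon>\<close> \<open>0 \<le> C1\<close> by simp_all
      then show ?thesis unfolding ring_distribs by linarith
    qed
    finally show "real (K + 1) * real N \<le> (1 + C1) * (real N + real N powr (2 / 3) / \<epsilon>)" .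
  qed (use \<open>0 < \<mu>0\<close> in simp)
  have "real (samples N b S (K + 1) 0) = real (K + 1) * (real N + 2 * (real S * real b))"
    by (simp add: samples_def algebra_simps)
  also have "\<dots> \<le> real (K + 1) * (real N + 2 * (real N / \<mu>0))"
    using inner by (intro mult_left_mono) auto
  also have "\<dots> = (1 + 2 / \<mu>0) * (real (K + 1) * real N)"
    by (simp add: algebra_simps add_divide_distrib)
  also note total
  finally show ?thesis by (simp only: mult.assoc)
qed

text \<open>
  Here \<open>n\<close> is the number of outer iterations, \<open>a\<close> stands for \<open>L + \<kappa>H\<close> and \<open>d\<close> for the initial gap.
  Inserting the batch size into the lower estimate of \<open>S * b\<close> and cancelling \<open>N powr (2 / 3)\<close> leaves
  \<open>S * \<mu>1 \<ge> c * N powr (1 / 3) / (2 * \<mu>0 * q)\<close>, which removes \<open>\<mu>0\<close>, \<open>\<mu>1\<close> and \<open>S\<close> from the bound.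
\<close>

lemma convergence_bound_le:
  fixes n :: real
  assumes "0 < N" "0 < \<mu>0" "0 < v0" "0 < c" "0 < q" "0 \<le> a" "0 < n" "0 < S"
    and "d \<le> D" "0 \<le> D" "0 < \<mu>1"
    and batch: "real b = \<mu>1 * real N powr (2 / 3)"
    and inner: "c * real N / (2 * \<mu>0 * q) \<le> real S * real b"
  shows "2 * a * d / (n * real S * \<mu>0 * \<mu>1 * v0)
    \<le> (4 * a * D * q / (c * v0)) / (n * real N powr (1 / 3))"
proof -
  define t where "t = real N powr (1 / 3)"
  define u where "u = real N powr (2 / 3)"
  have tu: "0 < t" "0 < u" "real N = t * u"
    using \<open>0 < N\<close> by (auto simp: t_def u_def powr_add[symmetric])
  have "c * t / (2 * \<mu>0 * q) * u \<le> real S * \<mu>1 * u"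
    using inner unfolding batch u_def[symmetric] by (simp add: tu(3) mult_ac)
  then have len: "c * t / (2 * \<mu>0 * q) \<le> real S * \<mu>1"
    using tu(2) by (simp only: mult_le_cancel_right_pos)
  have "2 * a * d / (n * real S * \<mu>0 * \<mu>1 * v0) \<le> 2 * a * D / (n * real S * \<mu>0 * \<mu>1 * v0)"
    using assms by (intro divide_right_mono mult_left_mono) auto
  also have "\<dots> = 2 * a * D / (n * \<mu>0 * v0 * (real S * \<mu>1))"
    by (simp add: mult_ac)
  also have "\<dots> \<le> 2 * a * D / (n * \<mu>0 * v0 * (c * t / (2 * \<mu>0 * q)))"
    using assms tu len by (intro divide_left_mono mult_left_mono) auto
  also have "\<dots> = (4 * a * D * q / (c * v0)) / (n * t)"
    using assms tu by (simp add: field_simps)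
  finally show ?thesis by (simp add: t_def)
qed


section \<open>Complexity with an explicit constant\<close>

text \<open>
  The convergence bound is at most \<open>\<epsilon>\<close> as soon as the number of outer iterations reaches this constant
  divided by \<open>N powr (1 / 3) * \<epsilon>\<close>. The bound on the initial gap enters as \<open>max D 0\<close> because the sign
  of \<open>D\<close> is unknown.
\<close>

definition outer_constant :: "real \<Rightarrow> real \<Rightarrow> real \<Rightarrow> real \<Rightarrow> real \<Rightarrow> real \<Rightarrow> real" where
  "outer_constant L \<kappa>H \<mu>0 v0 D c =
     4 * (L + \<kappa>H) * max D 0 * (1 + \<mu>0 * L\<^sup>2 / (2 * (L + 2 * \<kappa>H))) / (c * v0)"

text \<open>
  The absolute value makes the constant positive for all values of \<open>L\<close> and \<open>\<kappa>H\<close>. It has to be chosen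
  before a run is given, and only the existence of a run determines the signs of these parameters.
\<close>

definition complexity_constant :: "real \<Rightarrow> real \<Rightarrow> real \<Rightarrow> real \<Rightarrow> real \<Rightarrow> real \<Rightarrow> real" where
  "complexity_constant L \<kappa>H \<mu>0 v0 D c =
     (1 + 2 / \<mu>0) * (1 + \<bar>outer_constant L \<kappa>H \<mu>0 v0 D c\<bar>)"

text \<open>
  The estimates above need the signs of the parameters, and these come from the existence of a run:
  \<open>L\<close> is nonnegative as a Lipschitz constant (of the first component gradient, as \<open>N \<ge> 1\<close>), and
  \<open>L + 2 * \<kappa>H\<close> is positive because the radius parameter is.
\<close>

lemma trsvr_complexity_explicit:
  fixes L \<kappa>H \<mu>0 v0 D c :: real and x :: "nat \<Rightarrow> nat \<Rightarrow> 'w \<Rightarrow> real^'d"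
  assumes "0 < \<mu>0" "0 < v0" "0 < c"
    and alg: "trsvr M N f b S \<alpha> x B H dx"
    and reg: "regular M N f S x H X f_inf L \<kappa>H"
    and "0 < \<mu>1"
    and \<alpha>: "\<alpha> = \<mu>0 * real b / (2 * (L + 2 * \<kappa>H) * real N powr (2 / 3))" "0 < \<alpha>"
    and b: "real b = \<mu>1 * real N powr (2 / 3)"
    and S: "int S \<le> max_inner_length N b L \<kappa>H \<mu>0"
      "c * real_of_int (max_inner_length N b L \<kappa>H \<mu>0) \<le> real S"
    and D: "(\<integral>\<omega>. objective N f (x 0 0 \<omega>) \<partial>M) - f_inf \<le> D"
    and bound: "convergence_bound M N f S x f_inf L \<kappa>H \<mu>0 \<mu>1 v0"
    and "0 < \<epsilon>"
  shows "sample_complexity M N f b S x \<epsilon>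
      \<le> ennreal (complexity_constant L \<kappa>H \<mu>0 v0 D c * (real N + real N powr (2 / 3) / \<epsilon>)) \<and>
    sample_complexity_random_output M N f b S x \<epsilon>
      \<le> ennreal (complexity_constant L \<kappa>H \<mu>0 v0 D c * (real N + real N powr (2 / 3) / \<epsilon>))"
proof -
  define q where "q = 1 + \<mu>0 * L\<^sup>2 / (2 * (L + 2 * \<kappa>H))"
  define C1 where "C1 = outer_constant L \<kappa>H \<mu>0 v0 D c"
  have C1_eq: "C1 = 4 * (L + \<kappa>H) * max D 0 * q / (c * v0)"
    by (simp add: C1_def outer_constant_def q_def)
  interpret trsvr M N f b S \<alpha> x B H dx by (fact alg)
  have pos: "0 < b" "0 < N" "0 < S" using batch_size inner_length by auto
  have A: "0 < L + 2 * \<kappa>H"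
    using \<alpha>(2) unfolding \<alpha>(1)
    by (rule radius_pos_imp_curvature_pos) (rule assms(1), rule powr_ge_zero)
  note reg' = reg[unfolded regular_def]
  have "1 \<in> {1..N}" using pos(2) by simp
  with reg' have "L-lipschitz_on UNIV (grad (f 1))" by blast
  then have "0 \<le> L" by (rule lipschitz_on_nonneg)
  with A have a: "0 \<le> L + \<kappa>H" by simp
  have q: "0 < q" using assms(1) A by (simp add: q_def add_pos_nonneg)
  have C1: "0 \<le> C1" using a q assms by (simp add: C1_eq)
  note inner = inner_samples_bounds[OF assms(1) A assms(3) pos(1,3) S, folded q_def]
  define r where "r = C1 / (real N powr (1 / 3) * \<epsilon>)"
  have r: "0 \<le> r" using C1 \<open>0 < \<epsilon>\<close> by (simp add: r_def)
  obtain K where K: "r \<le> real (K + 1)" "real (K + 1) \<le> r + 1"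
    using outer_iteration_count[OF r] .
  have "2 * (L + \<kappa>H) * ((\<integral>\<omega>. objective N f (x 0 0 \<omega>) \<partial>M) - f_inf)
      / (real (K + 1) * real S * \<mu>0 * \<mu>1 * v0) \<le> C1 / (real (K + 1) * real N powr (1 / 3))"
    unfolding C1_eq using assms pos a q D \<open>0 < \<mu>1\<close> b inner(2)
    by (intro convergence_bound_le[where b = b]) auto
  also have "\<dots> \<le> \<epsilon>"
  proof -
    have t: "0 < real N powr (1 / 3)" using pos(2) by simp
    have "C1 \<le> real (K + 1) * (real N powr (1 / 3) * \<epsilon>)"
      using K(1) t \<open>0 < \<epsilon>\<close> unfolding r_def by (simp only: pos_divide_le_eq mult_pos_pos)
    then show ?thesis
      using t by (simp add: pos_divide_le_eq mult_ac add_pos_nonneg)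
  qed
  finally have average: "(\<integral>\<^sup>+\<omega>. ennreal (1 / (real (K + 1) * real S) *
      (\<Sum>k\<in>{0..K}. \<Sum>s\<in>{0..<S}. (norm (grad (objective N f) (x k s \<omega>)))\<^sup>2)) \<partial>M) \<le> ennreal \<epsilon>"
    using bound[unfolded convergence_bound_def, rule_format, of K]
    by (rule order_trans[OF _ ennreal_leI, rotated])
  have grad_meas: "grad (objective N f) \<in> borel_measurable borel"
    by (rule borel_measurable_grad_objective) (use reg' in blast)+
  have "x k s \<in> borel_measurable M" if "s < S" for k s
    using x_measurable that by simp
  note complexity = sample_complexity_le_of_average[OF pos(3) this grad_meas average]
  have "real (samples N b S (K + 1) 0)
      \<le> complexity_constant L \<kappa>H \<mu>0 v0 D c * (real N + real N powr (2 / 3) / \<epsilon>)"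
    using samples_le_of_outer_count[OF pos(2) assms(1) \<open>0 < \<epsilon>\<close> C1 inner(1) K(2)[unfolded r_def]] C1
    by (simp add: complexity_constant_def C1_def)
  then have cost: "of_nat (samples N b S (K + 1) 0)
      \<le> ennreal (complexity_constant L \<kappa>H \<mu>0 v0 D c * (real N + real N powr (2 / 3) / \<epsilon>))"
    by (simp add: ennreal_of_nat_eq_real_of_nat ennreal_leI)
  show ?thesis
    by (rule conjI[OF order_trans[OF complexity(1) cost] order_trans[OF complexity(2) cost]])
qed

theorem corollary4p6:
  fixes L \<kappa>H \<mu>0 v0 D c :: real
  assumes "0 < \<mu>0" "\<mu>0 < 1" "0 < v0" "v0 < 1" "0 < c"
  shows "\<exists>C>0. \<forall>(M :: 'w measure) N (f :: nat \<Rightarrow> real^'d \<Rightarrow> real) b S \<alpha> x B H dx X f_inf \<mu>1 \<epsilon>.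
    trsvr M N f b S \<alpha> x B H dx \<longrightarrow>
    regular M N f S x H X f_inf L \<kappa>H \<longrightarrow>
    unbiased M N f b S x B \<longrightarrow>
    0 < \<mu>1 \<longrightarrow> \<mu>1 \<le> 1 \<longrightarrow>
    \<alpha> = \<mu>0 * real b / (2 * (L + 2 * \<kappa>H) * real N powr (2 / 3)) \<longrightarrow>
    0 < \<alpha> \<longrightarrow> \<alpha> \<le> 1 \<longrightarrow>
    real b = \<mu>1 * real N powr (2 / 3) \<longrightarrow>
    int S \<le> max_inner_length N b L \<kappa>H \<mu>0 \<longrightarrow>
    c * real_of_int (max_inner_length N b L \<kappa>H \<mu>0) \<le> real S \<longrightarrow>
    integrable M (\<lambda>\<omega>. objective N f (x 0 0 \<omega>)) \<longrightarrow>
    (\<integral>\<omega>. objective N f (x 0 0 \<omega>) \<partial>M) - f_inf \<le> D \<longrightarrow>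
    convergence_bound M N f S x f_inf L \<kappa>H \<mu>0 \<mu>1 v0 \<longrightarrow>
    0 < \<epsilon> \<longrightarrow>
    sample_complexity M N f b S x \<epsilon> \<le> ennreal (C * (real N + real N powr (2 / 3) / \<epsilon>)) \<and>
    sample_complexity_random_output M N f b S x \<epsilon>
      \<le> ennreal (C * (real N + real N powr (2 / 3) / \<epsilon>))"
proof (intro exI[of _ "complexity_constant L \<kappa>H \<mu>0 v0 D c"] conjI[of "0 < _"] allI impI)
  show "0 < complexity_constant L \<kappa>H \<mu>0 v0 D c"
    using assms(1) by (simp add: complexity_constant_def add_pos_nonneg)
qed (rule trsvr_complexity_explicit[OF assms(1,3,5)]; assumption)

end
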